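(* Let $F$ be a number field of degree $n$, and let $p \ge 5$ be a prime. Suppose that (i) $\gcd(n,(p-1)/2)=1$; (ii) $p$ is totally ramified in $F$. Then there are no $\lambda, \mu \in \mathcal{O}_F^\times$ with $\lambda + \mu = 1$.
   Context: $\mathcal{O}_F$ denotes the ring of integers of $F$ and $\mathcal{O}_F^\times$ its unit group. *)

theory Defs
  imports "HOL-Algebra.Algebraic_Closure_Type" "HOL-Algebra.Ideal_Product"
begin

text \<open>
  A number field is given as a subfield \<open>F\<close> of an arbitrary field of characteristic 0 (the
  ambient type); \<open>ring.dimension\<close> is a predicate that includes finite dimensionality.
\<close>

definition number_field_of_degree :: "nat \<Rightarrow> 'a::field_char_0 set \<Rightarrow> bool" where
  "number_field_of_degree n F \<longleftrightarrow>
     subfield F ring_of_type_algebra \<and> ring.dimension ring_of_type_algebra n \<rat> F"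

definition ring_of_integers :: "'a::field_char_0 set \<Rightarrow> 'a ring" where
  "ring_of_integers F = ring_of_type_algebra \<lparr> carrier := {x \<in> F. algebraic_int x} \<rparr>"

text \<open>
  \<open>p\<close> is totally ramified in \<open>F\<close> if \<open>p \<O>\<^sub>F = P\<^sup>n\<close> for a prime ideal \<open>P\<close>, where \<open>n = [F : \<rat>]\<close>.
  The power is taken in the multiplicative monoid of ideals.
\<close>

definition totally_ramified :: "nat \<Rightarrow> 'a::field_char_0 set \<Rightarrow> bool" where
  "totally_ramified p F \<longleftrightarrow>
     (\<exists>n P. number_field_of_degree n F \<and> primeideal P (ring_of_integers F) \<and>
        PIdl\<^bsub>ring_of_integers F\<^esub> (of_nat p) = P [^]\<^bsub>ideals_set (ring_of_integers F)\<^esub> n)"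

end

theory Submission
  imports Defs "HOL-Number_Theory.Euler_Criterion"
begin

text \<open>
  Let \<open>p \<O>\<^sub>F = P\<^sup>n\<close> and choose \<open>v\<^sub>i \<in> P\<^sup>i - P\<^sup>i\<^sup>+\<^sup>1\<close> for \<open>i < n\<close>, with \<open>v\<^sub>0 = 1\<close>. An integral linear
  combination of the \<open>v\<^sub>i\<close> lies in \<open>p \<O>\<^sub>F\<close> only if \<open>p\<close> divides its coefficients, so the linear
  relation that an integer \<open>x\<close> of \<open>F\<close> and the \<open>v\<^sub>i\<close> satisfy for reasons of dimension can be solved
  for \<open>x\<close> modulo \<open>p\<close>; hence \<open>x\<close> is congruent modulo \<open>P\<close> to a rational integer \<open>a\<close>.

  For \<open>w = x - a\<close> the power \<open>w\<^sup>n\<close> is divisible by \<open>p\<close>, so the minimal polynomial \<open>f\<close> of \<open>w\<close> is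
  congruent to \<open>X\<^sup>d\<close> modulo \<open>p\<close>, where \<open>d\<close> divides \<open>n\<close>. If \<open>x\<close> is a unit, then \<open>f(-a)\<close>, which up to
  sign is the norm of \<open>x\<close> from \<open>\<rat>(x)\<close> to \<open>\<rat>\<close>, is \<open>1\<close> or \<open>-1\<close>. Hence \<open>a\<^sup>2\<^sup>n\<close> is \<open>1\<close> modulo \<open>p\<close> and, as
  \<open>n\<close> is coprime to \<open>(p - 1) / 2\<close>, already \<open>a\<close> is \<open>1\<close> or \<open>-1\<close> modulo \<open>p\<close>. Two units with sum \<open>1\<close>
  would make \<open>p\<close> divide \<open>-1\<close>, \<open>1\<close> or \<open>3\<close>.
\<close>

section \<open>Weakly Eisenstein polynomials\<close>

definition weakly_eisenstein :: "'a::comm_semiring_1 \<Rightarrow> 'a poly \<Rightarrow> bool" where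
  "weakly_eisenstein p f \<longleftrightarrow> (\<forall>i<degree f. p dvd coeff f i)"

lemma not_dvd_coeff_mult_lowest:
  fixes f g :: "'a::idom poly"
  assumes p: "prime_elem p"
    and f: "\<not> p dvd coeff f i" "\<And>k. k < i \<Longrightarrow> p dvd coeff f k"
    and g: "\<not> p dvd coeff g j" "\<And>k. k < j \<Longrightarrow> p dvd coeff g k"
  shows "\<not> p dvd coeff (f * g) (i + j)"
proof -
  have "coeff (f * g) (i + j) = coeff f i * coeff g j
      + (\<Sum>k\<in>{..i + j} - {i}. coeff f k * coeff g (i + j - k))"
    by (simp add: coeff_mult sum.remove[of _ i])
  moreover have "p dvd (\<Sum>k\<in>{..i + j} - {i}. coeff f k * coeff g (i + j - k))"
  proof (rule dvd_sum)
    fix k assume "k \<in> {..i + j} - {i}"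
    then consider "k < i" | "i + j - k < j" by fastforce
    then show "p dvd coeff f k * coeff g (i + j - k)"
      by cases (simp_all add: f(2) g(2) dvd_mult dvd_mult2)
  qed
  ultimately show ?thesis
    using p f(1) g(1) by (simp add: dvd_add_left_iff prime_elem_dvd_mult_iff)
qed

lemma weakly_eisenstein_monic_factor:
  fixes f g :: "'a::idom poly"
  assumes p: "prime_elem p"
    and monic: "lead_coeff f = 1" "lead_coeff g = 1"
    and fg: "weakly_eisenstein p (f * g)"
  shows "weakly_eisenstein p f"
proof -
  have lead: "\<not> p dvd coeff f (degree f)" "\<not> p dvd coeff g (degree g)"
    using monic p by (auto simp: prime_elem_def)
  obtain i where i: "\<not> p dvd coeff f i" "\<And>k. k < i \<Longrightarrow> p dvd coeff f k"
    using exists_least_iff[of "\<lambda>i. \<not> p dvd coeff f i"] lead(1) by blast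
  obtain j where j: "\<not> p dvd coeff g j" "\<And>k. k < j \<Longrightarrow> p dvd coeff g k"
    using exists_least_iff[of "\<lambda>j. \<not> p dvd coeff g j"] lead(2) by blast
  have "\<not> p dvd coeff (f * g) (i + j)"
    using p i j by (rule not_dvd_coeff_mult_lowest)
  then have "degree (f * g) \<le> i + j"
    using fg not_less unfolding weakly_eisenstein_def by blast
  moreover have "degree (f * g) = degree f + degree g"
    using monic by (intro degree_mult_eq) auto
  moreover have "j \<le> degree g"
    using j(2) lead(2) not_less by blast
  ultimately show ?thesis
    using i(2) unfolding weakly_eisenstein_def by simp
qed

lemma poly_weakly_eisenstein_cong:
  fixes f :: "int poly"
  assumes "lead_coeff f = 1" "weakly_eisenstein p f"
  shows "[poly f a = a ^ degree f] (mod p)"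
proof -
  have "poly f a = (\<Sum>i<degree f. coeff f i * a ^ i) + a ^ degree f"
    using assms(1) by (simp add: poly_altdef flip: lessThan_Suc_atMost)
  moreover have "p dvd (\<Sum>i<degree f. coeff f i * a ^ i)"
    using assms(2) by (auto simp: weakly_eisenstein_def intro!: dvd_sum)
  ultimately show ?thesis
    by (simp add: cong_iff_dvd_diff)
qed

section \<open>Minimal polynomials of algebraic integers\<close>

abbreviation ipoly :: "int poly \<Rightarrow> 'a::field_char_0 \<Rightarrow> 'a" where
  "ipoly f x \<equiv> poly (map_poly of_int f) x"

lemma ipoly_add: "ipoly (f + g) x = ipoly f x + ipoly g x"
proof -
  have "map_poly of_int (f + g) = (map_poly of_int f + map_poly of_int g :: 'a poly)"
    by (rule poly_eqI) (simp add: coeff_map_poly)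
  then show ?thesis by simp
qed

lemma ipoly_mult: "ipoly (f * g) x = ipoly f x * ipoly g x"
proof -
  have "map_poly of_int (f * g) = (map_poly of_int f * map_poly of_int g :: 'a poly)"
    by (rule poly_eqI) (simp add: coeff_map_poly coeff_mult)
  then show ?thesis by simp
qed

lemma ipoly_smult: "ipoly (smult c f) x = of_int c * ipoly f x"
  by (simp add: map_poly_smult)

lemma ipoly_sum: "ipoly (\<Sum>i\<in>I. f i) x = (\<Sum>i\<in>I. ipoly (f i) x)"
  by (induction I rule: infinite_finite_induct) (simp_all add: ipoly_add)

lemma ipoly_altdef: "ipoly f x = (\<Sum>i\<le>degree f. of_int (coeff f i) * x ^ i)"
  by (simp add: poly_altdef coeff_map_poly degree_map_poly)

lemma ipoly_pcompose: "ipoly (f \<circ>\<^sub>p g) x = ipoly f (ipoly g x)"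
  by (induction f) (simp_all add: pcompose_pCons map_poly_pCons ipoly_add ipoly_mult)

lemma ipoly_reflect_poly:
  assumes "x \<noteq> 0"
  shows "ipoly (reflect_poly f) x = x ^ degree f * ipoly f (inverse x)"
proof -
  have "map_poly of_int (reflect_poly f) = (reflect_poly (map_poly of_int f) :: 'a poly)"
    by (rule poly_eqI) (simp add: coeff_map_poly coeff_reflect_poly degree_map_poly)
  then show ?thesis
    using assms by (simp add: poly_reflect_poly_nz degree_map_poly)
qed

definition minimal_int_poly :: "int poly \<Rightarrow> 'a::field_char_0 \<Rightarrow> bool" where
  "minimal_int_poly f x \<longleftrightarrow> lead_coeff f = 1 \<and> (\<forall>g. ipoly g x = 0 \<longleftrightarrow> f dvd g)"

lemma minimal_int_polyD:
  assumes "minimal_int_poly f x"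
  shows "lead_coeff f = 1" "ipoly f x = 0" "ipoly g x = 0 \<Longrightarrow> f dvd g"
  using assms by (simp_all add: minimal_int_poly_def)

lemma dvd_smult_primitive_iff:
  fixes f g :: "int poly"
  assumes "content f = 1" "c \<noteq> 0"
  shows "f dvd smult c g \<longleftrightarrow> f dvd g"
proof
  assume "f dvd smult c g"
  then have "fract_poly f dvd smult (to_fract c) (fract_poly g)"
    using fract_poly_dvd[of f "smult c g"] by simp
  then show "f dvd g"
    using assms by (simp add: dvd_smult_iff fract_poly_dvdD)
qed (rule dvd_smult)

lemma primitive_least_degree_dvd:
  fixes x :: "'a::field_char_0"
  assumes f: "f \<noteq> 0" "content f = 1" "ipoly f x = 0"
    and least: "\<And>g. g \<noteq> 0 \<Longrightarrow> ipoly g x = 0 \<Longrightarrow> degree f \<le> degree g"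
    and g: "ipoly g x = 0"
  shows "f dvd g"
proof -
  define r where "r = pseudo_mod g f"
  obtain c q where c: "c \<noteq> 0" and division: "smult c g = f * q + r"
    using pseudo_mod(1)[OF f(1), of g] unfolding r_def by blast
  have "ipoly r x = 0"
    using arg_cong[OF division, of "\<lambda>h. ipoly h x"] f(3) g
    by (simp add: ipoly_add ipoly_mult ipoly_smult)
  then have "r = 0"
    using least[of r] pseudo_mod(2)[OF f(1), of g] unfolding r_def by linarith
  then have "f dvd smult c g"
    using division by simp
  then show ?thesis
    using dvd_smult_primitive_iff[OF f(2) c] by blast
qed

lemma minimal_int_poly_exists:
  fixes x :: "'a::field_char_0"
  assumes "algebraic_int x"
  obtains f where "minimal_int_poly f x"
proof -
  obtain h where h: "ipoly h x = 0" "lead_coeff h = 1"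
    using assms by (auto simp: algebraic_int_altdef_ipoly)
  then have "h \<noteq> 0 \<and> ipoly h x = 0" by auto
  then obtain g where g: "g \<noteq> 0" "ipoly g x = 0"
    and least: "\<And>k. k \<noteq> 0 \<Longrightarrow> ipoly k x = 0 \<Longrightarrow> degree g \<le> degree k"
    using ex_has_least_nat[of "\<lambda>k. k \<noteq> 0 \<and> ipoly k x = 0" h degree] by blast
  define f where "f = primitive_part g"
  have "of_int (content g) * ipoly f x = 0"
    using g(2) unfolding f_def by (metis content_times_primitive_part ipoly_smult)
  then have root: "ipoly f x = 0" using g(1) by simp
  have dvd: "f dvd k" if "ipoly k x = 0" for k
  proof (rule primitive_least_degree_dvd[OF _ _ root _ that])
    show "f \<noteq> 0" "content f = 1" using g(1) by (simp_all add: f_def)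
  qed (simp add: f_def least)
  define u where "u = lead_coeff f"
  have "u dvd 1"
    using dvd[OF h(1)] h(2) unfolding u_def by (metis dvdE dvd_triv_left lead_coeff_mult)
  then have u: "u * u = 1" by (auto simp: abs_eq_iff')
  have "ipoly k x = 0 \<longleftrightarrow> f dvd k" for k
    using dvd root by (auto simp: ipoly_mult elim!: dvdE)
  moreover have "smult u f dvd k \<longleftrightarrow> f dvd k" for k
    using mult_unit_dvd_iff'[of "[:u:]" f k] \<open>u dvd 1\<close> by (simp add: is_unit_const_poly_iff)
  ultimately have "minimal_int_poly (smult u f) x"
    using u by (auto simp: minimal_int_poly_def u_def)
  then show thesis by (rule that)
qed

lemma algebraic_int_divides_power_weakly_eisenstein:
  fixes x y :: "'a::field_char_0"
  assumes "algebraic_int y" "x ^ n = of_int p * y" "n > 0"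
  obtains g where "lead_coeff g = 1" "ipoly g x = 0" "weakly_eisenstein p g"
proof -
  obtain h where h: "ipoly h y = 0" "lead_coeff h = 1"
    using assms(1) by (auto simp: algebraic_int_altdef_ipoly)
  define m where "m = degree h"
  \<comment> \<open>\<open>g = p\<^sup>m h(X\<^sup>n / p)\<close>\<close>
  define g where "g = (\<Sum>j\<le>m. monom (coeff h j * p ^ (m - j)) (n * j))"
  have coeff: "coeff g i = (\<Sum>j\<le>m. if n * j = i then coeff h j * p ^ (m - j) else 0)" for i
    by (simp add: g_def coeff_sum)
  have lead: "coeff g (n * m) = 1"
    using h(2) \<open>n > 0\<close> by (simp add: coeff m_def)
  moreover have "degree g \<le> n * m"
    unfolding g_def by (intro degree_sum_le) (auto intro: order_trans[OF degree_monom_le])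
  ultimately have degree: "degree g = n * m"
    using le_degree[of g "n * m"] by simp
  have "weakly_eisenstein p g"
    unfolding weakly_eisenstein_def coeff degree by (auto intro!: dvd_sum simp: dvd_power)
  moreover have "ipoly g x = of_int p ^ m * ipoly h y"
  proof -
    have "of_int (coeff h j * p ^ (m - j)) * x ^ (n * j)
        = of_int p ^ m * (of_int (coeff h j) * y ^ j)" if "j \<le> m" for j
    proof -
      have "x ^ (n * j) = of_int p ^ j * y ^ j"
        by (simp add: power_mult assms(2) power_mult_distrib)
      moreover have "(of_int p :: 'a) ^ m = of_int p ^ (m - j) * of_int p ^ j"
        using that by (simp flip: power_add)
      ultimately show ?thesis by (simp add: mult_ac)
    qed
    moreover have "ipoly g x = (\<Sum>j\<le>m. of_int (coeff h j * p ^ (m - j)) * x ^ (n * j))"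
      by (simp add: g_def ipoly_sum map_poly_monom poly_monom)
    ultimately show ?thesis
      by (simp add: ipoly_altdef[of h] sum_distrib_left del: of_int_mult flip: m_def)
  qed
  ultimately show thesis
    using that[of g] lead degree h(1) by simp
qed

lemma minimal_int_poly_weakly_eisenstein:
  fixes x y :: "'a::field_char_0"
  assumes f: "minimal_int_poly f x" and p: "prime_elem p"
    and y: "algebraic_int y" "x ^ n = of_int p * y" "n > 0"
  shows "weakly_eisenstein p f"
proof -
  obtain g where g: "lead_coeff g = 1" "ipoly g x = 0" "weakly_eisenstein p g"
    using algebraic_int_divides_power_weakly_eisenstein[OF y] .
  obtain q where q: "g = f * q"
    using minimal_int_polyD(3)[OF f g(2)] by (elim dvdE)
  moreover have "lead_coeff q = 1"
    using g(1) minimal_int_polyD(1)[OF f] unfolding q by (simp add: lead_coeff_mult)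
  ultimately show ?thesis
    using weakly_eisenstein_monic_factor[OF p minimal_int_polyD(1)[OF f]] g(3) by blast
qed

lemma minimal_int_poly_is_unit:
  fixes x :: "'a::field_char_0"
  assumes f: "minimal_int_poly f x" and "x \<noteq> of_int a" "algebraic_int (inverse (x - of_int a))"
  shows "is_unit (poly f a)"
proof -
  obtain h where h: "ipoly h (inverse (x - of_int a)) = 0" "lead_coeff h = 1"
    using assms(3) by (auto simp: algebraic_int_altdef_ipoly)
  have "ipoly (reflect_poly h \<circ>\<^sub>p [:- a, 1:]) x = 0"
    using assms(2) h(1) by (simp add: ipoly_pcompose ipoly_reflect_poly map_poly_pCons)
  then have "f dvd reflect_poly h \<circ>\<^sub>p [:- a, 1:]"
    by (rule minimal_int_polyD(3)[OF f])
  then have "poly f a dvd poly (reflect_poly h \<circ>\<^sub>p [:- a, 1:]) a"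
    by (auto elim!: dvdE)
  then show ?thesis
    using h(2) by (simp add: poly_pcompose)
qed

lemma minimal_int_poly_residue_cong:
  fixes x :: "'a::field_char_0"
  assumes f: "minimal_int_poly f x" "weakly_eisenstein p f"
    and "x \<noteq> of_int a" "algebraic_int (inverse (x - of_int a))"
  shows "[a ^ (2 * degree f) = 1] (mod p)"
proof -
  have "is_unit (poly f a)"
    using minimal_int_poly_is_unit assms by blast
  then have "poly f a ^ 2 = 1"
    by (auto simp: power2_eq_1_iff abs_eq_iff')
  moreover have "[poly f a ^ 2 = (a ^ degree f) ^ 2] (mod p)"
    using minimal_int_polyD(1)[OF f(1)] f(2) by (intro cong_pow poly_weakly_eisenstein_cong)
  ultimately show ?thesis
    by (simp add: cong_sym_eq mult.commute flip: power_mult)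
qed

section \<open>Congruences\<close>

lemma cong_pow_gcd:
  fixes a m :: int
  assumes "[a ^ i = 1] (mod m)" "[a ^ j = 1] (mod m)"
  shows "[a ^ gcd i j = 1] (mod m)"
proof (cases "i = 0")
  case False
  then obtain u v where uv: "i * u = j * v + gcd i j"
    using bezout_nat by blast
  have "[(a ^ j) ^ v * a ^ gcd i j = 1 ^ v * a ^ gcd i j] (mod m)"
    using assms(2) by (intro cong_mult cong_pow) auto
  moreover have "[(a ^ i) ^ u = 1 ^ u] (mod m)"
    using assms(1) by (rule cong_pow)
  moreover have "(a ^ i) ^ u = (a ^ j) ^ v * a ^ gcd i j"
    by (simp add: uv flip: power_mult power_add)
  ultimately show ?thesis
    by (metis cong_sym cong_trans mult_1 power_one)
qed (use assms in simp)

lemma cong_pow_double_one_imp_cong_pm_one: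
  fixes a :: int and n p :: nat
  assumes p: "prime p" "p > 2"
    and coprime: "gcd n ((p - 1) div 2) = 1" and n: "n > 0"
    and a: "[a ^ (2 * n) = 1] (mod int p)"
  shows "[a = 1] (mod int p) \<or> [a = - 1] (mod int p)"
proof -
  have "\<not> int p dvd a"
  proof
    assume "int p dvd a"
    then have "int p dvd a ^ (2 * n)" using n by (simp add: dvd_trans[OF _ dvd_power])
    then have "int p dvd 1" using a by (metis cong_dvd_iff)
    then show False using p(2) by simp
  qed
  then have "(Legendre a (int p)) ^ 2 = 1"
    by (simp add: Legendre_def cong_0_iff)
  moreover have "[(Legendre a (int p)) ^ 2 = (a ^ ((p - 1) div 2)) ^ 2] (mod int p)"
    using p by (intro cong_pow euler_criterion) auto
  ultimately have "[(a ^ 2) ^ ((p - 1) div 2) = 1] (mod int p)"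
    by (simp add: cong_sym_eq mult.commute flip: power_mult)
  then have "[(a ^ 2) ^ gcd n ((p - 1) div 2) = 1] (mod int p)"
    using a by (intro cong_pow_gcd) (simp_all add: power_mult)
  then have "int p dvd (a - 1) * (a + 1)"
    unfolding coprime by (simp add: cong_iff_dvd_diff algebra_simps power2_eq_square)
  then show ?thesis
    using p(1) by (auto simp: prime_dvd_mult_iff cong_iff_dvd_diff)
qed

section \<open>Powers of ideals\<close>

context cring
begin

lemma ideal_pow_0: "I [^]\<^bsub>ideals_set R\<^esub> (0::nat) = carrier R"
  by (simp add: ideals_set_def)

lemma ideal_pow_Suc: "I [^]\<^bsub>ideals_set R\<^esub> Suc k = (I [^]\<^bsub>ideals_set R\<^esub> k) \<cdot> I"
  by (simp add: nat_pow_def ideals_set_def)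

lemma ideal_pow_is_ideal:
  assumes "ideal I R"
  shows "ideal (I [^]\<^bsub>ideals_set R\<^esub> (k::nat)) R"
  using assms
  by (induction k) (simp_all only: ideal_pow_0 ideal_pow_Suc oneideal ideal_prod_is_ideal)

lemma ideal_pow_1:
  assumes "ideal I R"
  shows "I [^]\<^bsub>ideals_set R\<^esub> (1::nat) = I"
  using assms comm_monoid.axioms(1)[OF ideals_set_is_comm_monoid]
  by (intro monoid.nat_pow_eone) (simp_all add: ideals_set_def)

lemma ideal_pow_antimono:
  assumes "ideal I R" "i \<le> j"
  shows "I [^]\<^bsub>ideals_set R\<^esub> (j::nat) \<subseteq> I [^]\<^bsub>ideals_set R\<^esub> i"
  using assms(2)
proof (induction rule: dec_induct)
  case (step k)
  then show ?case
    using ideal_prod_inter[OF ideal_pow_is_ideal[OF assms(1), of k] assms(1)]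
    unfolding ideal_pow_Suc by blast
qed simp

lemma nat_pow_mem_ideal_pow:
  assumes "ideal I R" "x \<in> I"
  shows "x [^] (k::nat) \<in> I [^]\<^bsub>ideals_set R\<^esub> k"
proof (induction k)
  case 0
  then show ?case unfolding ideal_pow_0 by simp
next
  case (Suc k)
  then show ?case
    using assms(2) unfolding ideal_pow_Suc by (simp add: ideal_prod.prod)
qed

lemma cgenideal_ideal_prod_subset:
  assumes "a \<in> carrier R" "ideal I R"
  shows "(PIdl a) \<cdot> I \<subseteq> (\<otimes>) a ` I"
proof
  interpret I: ideal I R by fact
  fix z assume "z \<in> (PIdl a) \<cdot> I"
  then show "z \<in> (\<otimes>) a ` I"
  proof induction
    case (prod i j)
    then obtain r where "r \<in> carrier R" "i = r \<otimes> a"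
      by (auto simp: cgenideal_def)
    then have "i \<otimes> j = a \<otimes> (r \<otimes> j)"
      using assms(1) I.Icarr[OF prod(2)] by (simp add: m_ac)
    moreover have "r \<otimes> j \<in> I"
      using \<open>r \<in> carrier R\<close> prod(2) by (rule I.I_l_closed[rotated])
    ultimately show ?case by blast
  next
    case (sum s t)
    then obtain x y where "x \<in> I" "s = a \<otimes> x" "y \<in> I" "t = a \<otimes> y" by blast
    then have "s \<oplus> t = a \<otimes> (x \<oplus> y)"
      using assms(1) I.Icarr by (simp add: r_distr)
    then show ?case
      using I.a_closed \<open>x \<in> I\<close> \<open>y \<in> I\<close> by blast
  qed
qed

end

lemma (in domain) cgenideal_ideal_pow_Suc_neq:
  assumes I: "ideal I R" "I \<noteq> carrier R"
    and a: "a \<in> carrier R" "a \<noteq> \<zero>" "PIdl a = I [^]\<^bsub>ideals_set R\<^esub> (n::nat)"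
    and i: "i \<le> n"
  shows "I [^]\<^bsub>ideals_set R\<^esub> Suc i \<noteq> I [^]\<^bsub>ideals_set R\<^esub> i"
proof
  assume stable: "I [^]\<^bsub>ideals_set R\<^esub> Suc i = I [^]\<^bsub>ideals_set R\<^esub> i"
  have "I [^]\<^bsub>ideals_set R\<^esub> Suc n = I [^]\<^bsub>ideals_set R\<^esub> n"
    using i by (induction rule: dec_induct) (metis stable, metis ideal_pow_Suc)
  then have "a \<in> (PIdl a) \<cdot> I"
    using cgenideal_self[OF a(1)] unfolding ideal_pow_Suc a(3) by simp
  then obtain x where x: "x \<in> I" "a = a \<otimes> x"
    using cgenideal_ideal_prod_subset[OF a(1) I(1)] by blast
  then have "x = \<one>"
    using a ideal.Icarr[OF I(1) x(1)] m_lcancel[of a \<one> x] by simp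
  then show False
    using x(1) I ideal.one_imp_carrier by blast
qed

section \<open>Subfields of finite degree over the rationals\<close>

lemma (in ring) dimension_intermediate_dvd:
  assumes K: "subfield K R" and L: "subfield L R" and E: "subring E R"
    and incl: "K \<subseteq> L" "L \<subseteq> E"
    and dim: "dimension d K L" "dimension n K E"
  shows "d dvd n"
proof -
  obtain Vs where Vs: "set Vs \<subseteq> carrier R" "Span K Vs = E"
    using exists_base[OF K dim(2)] by blast
  have "subalgebra L E R"
  proof (intro subalgebra.intro subalgebra_axioms.intro)
    show "subgroup E (add_monoid R)" using E by (rule subring.axioms(1))
    show "k \<otimes> v \<in> E" if "k \<in> L" "v \<in> E" for k v
      using that incl(2) subringE(6)[OF E] by blast
  qed
  then have "Span L Vs \<subseteq> E"
    using subalgebra_Span_incl[OF L] Span_base_incl[OF K Vs(1)] Vs(2) by blast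
  moreover have "Span K Us \<subseteq> Span L Us" for Us
    using incl(1) by (induction Us) (simp, simp add: subset_iff line_extension_mem_iff, blast)
  then have "E \<subseteq> Span L Vs" using Vs(2) by blast
  ultimately have "finite_dimension L E"
    using Span_finite_dimension[OF L Vs(1)] by simp
  then obtain m where "dimension m L E" by blast
  then have "dimension (d * m) K E"
    by (rule telescopic_base[OF K L dim(1)])
  then have "n = d * m"
    by (rule dimension_is_inj[OF K dim(2)])
  then show ?thesis by simp
qed

lemma ring_of_type_algebra_simps [simp]:
  "carrier ring_of_type_algebra = UNIV"
  "\<zero>\<^bsub>ring_of_type_algebra\<^esub> = 0"
  "\<one>\<^bsub>ring_of_type_algebra\<^esub> = 1"
  "x \<oplus>\<^bsub>ring_of_type_algebra\<^esub> y = x + y"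
  "x \<otimes>\<^bsub>ring_of_type_algebra\<^esub> y = x * y"
  by (simp_all add: ring_of_type_algebra_def)

interpretation type_field: domain "ring_of_type_algebra :: 'a::field ring"
  by (rule field.axioms(1)[OF field_from_type_algebra])

lemma ring_of_type_algebra_a_inv [simp]: "\<ominus>\<^bsub>ring_of_type_algebra\<^esub> (x :: 'a::field) = - x"
  by (rule type_field.minus_equality) simp_all

lemma ring_of_type_algebra_nat_pow [simp]:
  "(x :: 'a::field) [^]\<^bsub>ring_of_type_algebra\<^esub> (k::nat) = x ^ k"
  by (induction k) (simp_all add: mult.commute)

lemma subfield_Rats: "subfield (\<rat> :: 'a::field_char_0 set) ring_of_type_algebra"
proof (rule field.subfieldI'[OF field_from_type_algebra])
  show "subring (\<rat> :: 'a set) ring_of_type_algebra"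
    by (rule type_field.subringI) auto
  fix k :: 'a assume k: "k \<in> \<rat> - {\<zero>\<^bsub>ring_of_type_algebra\<^esub>}"
  then have "inv\<^bsub>ring_of_type_algebra\<^esub> k = inverse k"
    by (intro type_field.comm_inv_char) auto
  then show "inv\<^bsub>ring_of_type_algebra\<^esub> k \<in> \<rat>" using k by simp
qed

lemma combine_eq_sum:
  assumes "length Ks = length Us"
  shows "type_field.combine Ks Us = (\<Sum>i<length Us. Ks ! i * Us ! i)"
  using assms
  by (induction Ks Us rule: list_induct2)
    (simp_all add: sum.lessThan_Suc_shift del: sum.lessThan_Suc)

lemma Rats_common_denominator:
  fixes A :: "'a::field_char_0 set"
  assumes "finite A" "A \<subseteq> \<rat>"
  obtains D :: int where "D \<noteq> 0" "\<And>a. a \<in> A \<Longrightarrow> of_int D * a \<in> \<int>"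
proof -
  have "\<exists>D::int. D \<noteq> 0 \<and> (\<forall>a\<in>A. of_int D * a \<in> \<int>)"
    using assms
  proof induction
    case (insert r A)
    then obtain D :: int where D: "D \<noteq> 0" "\<forall>a\<in>A. of_int D * a \<in> \<int>" by auto
    obtain m b where b: "b > 0" "r = of_int m / of_int b"
      using insert.prems by (auto elim: Rats_cases')
    have "of_int (D * b) * r = of_int (D * m)"
      using b by simp
    moreover have "of_int (D * b) * a \<in> \<int>" if "a \<in> A" for a
      using Ints_mult[OF Ints_of_int[of b] D(2)[rule_format, OF that]] by (simp add: mult_ac)
    ultimately have "\<forall>a\<in>insert r A. of_int (D * b) * a \<in> \<int>"
      by (metis Ints_of_int insert_iff)
    then show ?case using D(1) b(1) by (intro exI[of _ "D * b"]) simp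
  qed (auto intro: exI[of _ 1])
  then show thesis using that by blast
qed

lemma Rats_list_primitive_poly:
  fixes rs :: "'a::field_char_0 list"
  assumes rs: "set rs \<subseteq> \<rat>" "\<not> set rs \<subseteq> {0}"
  obtains k :: "int poly" and q
  where "content k = 1" "degree k < length rs"
    "\<And>i. i < length rs \<Longrightarrow> of_int (coeff k i) = q * rs ! i"
proof -
  obtain D :: int where D: "D \<noteq> 0" "\<And>r. r \<in> set rs \<Longrightarrow> of_int D * r \<in> \<int>"
    using Rats_common_denominator[OF _ rs(1)] by auto
  then have "\<exists>z. of_int D * r = of_int z" if "r \<in> set rs" for r
    using that by (auto elim: Ints_cases)
  then obtain z where z: "\<And>r. r \<in> set rs \<Longrightarrow> of_int D * r = of_int (z r)"
    by metis
  define h where "h = Poly (map z rs)"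
  have coeff: "of_int (coeff h i) = of_int D * rs ! i" if "i < length rs" for i
    using that by (simp add: h_def nth_default_def z)
  obtain i where i: "i < length rs" "rs ! i \<noteq> 0"
    using rs(2) by (auto simp: subset_iff in_set_conv_nth)
  then have "h \<noteq> 0"
    using coeff[OF i(1)] D(1) by auto
  have "of_int (coeff (primitive_part h) i) = of_int D / of_int (content h) * rs ! i"
    if "i < length rs" for i
  proof -
    have "of_int (content h) * of_int (coeff (primitive_part h) i) = (of_int (coeff h i) :: 'a)"
      by (metis coeff_smult content_times_primitive_part of_int_mult)
    then show ?thesis
      using coeff[OF that] \<open>h \<noteq> 0\<close> by (simp add: field_simps)
  qed
  moreover have "degree h < length rs"
    using \<open>h \<noteq> 0\<close> i(1) unfolding h_def by (intro degree_lessI) (auto simp: nth_default_def)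
  ultimately show thesis
    using that[of "primitive_part h" "of_int D / of_int (content h)"] \<open>h \<noteq> 0\<close> by simp
qed

lemma dimension_Rats_primitive_relation:
  fixes u :: "nat \<Rightarrow> 'a::field_char_0"
  assumes dim: "type_field.dimension n \<rat> E" and u: "\<And>i. i \<le> n \<Longrightarrow> u i \<in> E"
  obtains k :: "int poly"
  where "content k = 1" "degree k \<le> n" "(\<Sum>i\<le>n. of_int (coeff k i) * u i) = 0"
proof -
  define us where "us = map u [0..<Suc n]"
  have us: "length us = Suc n" "\<And>i. i \<le> n \<Longrightarrow> us ! i = u i"
    by (simp_all add: us_def less_Suc_eq_le del: upt_Suc)
  have "type_field.dependent \<rat> us"
    using type_field.independent_length_le_dimension[OF subfield_Rats dim, of us] u
    by (auto simp: us_def less_Suc_eq_le image_subset_iff simp del: upt_Suc)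
  then obtain rs where rs: "length rs = length us" "type_field.combine rs us = 0"
      "set rs \<subseteq> \<rat>" "set rs \<noteq> {0}"
    using type_field.dependent_imp_non_trivial_combine[OF subfield_Rats, of us] by auto
  then have "\<not> set rs \<subseteq> {0}"
    using us(1) by (cases rs) auto
  then obtain k :: "int poly" and q where k: "content k = 1" "degree k < length rs"
      and coeff: "\<And>i. i < length rs \<Longrightarrow> of_int (coeff k i) = q * rs ! i"
    using Rats_list_primitive_poly[OF rs(3)] by blast
  have "(\<Sum>i\<le>n. of_int (coeff k i) * u i) = q * type_field.combine rs us"
    using rs(1) us coeff
    by (simp add: combine_eq_sum sum_distrib_left lessThan_Suc_atMost mult.assoc)
  then show thesis
    using that[OF k(1)] k(2) rs(1,2) us(1) by simp
qed

lemma eval_rev_coeffs: "type_field.eval (rev (coeffs f)) x = poly f x"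
proof -
  have "type_field.eval (rev cs) x = poly (Poly cs) x" for cs
    by (induction cs rule: rev_induct) (simp_all add: Poly_snoc poly_monom)
  then show ?thesis by (metis Poly_coeffs)
qed

lemma rev_coeffs_in_univ_poly:
  assumes "set (coeffs f) \<subseteq> (K :: 'a::field set)"
  shows "rev (coeffs f) \<in> carrier (K [X]\<^bsub>ring_of_type_algebra\<^esub>)"
  using assms
  by (cases "f = 0")
    (simp_all add: polynomial_def hd_rev last_coeffs_eq_coeff_degree flip: univ_poly_carrier)

lemma degree_Irr_le:
  fixes K :: "'a::field set"
  assumes K: "subfield K ring_of_type_algebra" and x: "(type_field.algebraic over K) x"
    and f: "f \<noteq> 0" "set (coeffs f) \<subseteq> K" "poly f x = 0"
  shows "Polynomials.degree (type_field.Irr K x) \<le> degree f"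
proof -
  note carrier = rev_coeffs_in_univ_poly[OF f(2)]
  have "type_field.eval (rev (coeffs f)) x = 0"
    using f(3) by (simp add: eval_rev_coeffs)
  then have "Polynomials.degree (type_field.Irr K x) \<le> Polynomials.degree (rev (coeffs f))"
    using type_field.Irr_minimal[OF K _ x carrier] f(1)
    by (intro type_field.pdivides_imp_degree_le[OF subfieldE(1)[OF K] _ carrier]
        type_field.IrrE(1)[OF K _ x]) simp_all
  then show ?thesis
    by (simp add: degree_eq_length_coeffs)
qed

lemma dimension_simple_extension_minimal_int_poly:
  fixes x :: "'a::field_char_0"
  assumes f: "minimal_int_poly f x"
  shows "type_field.dimension (degree f) \<rat> (type_field.simple_extension \<rat> x)"
proof -
  let ?K = "type_field.simple_extension \<rat> x"
  define d where "d = Polynomials.degree (type_field.Irr \<rat> x)"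
  let ?q = "map_poly of_int f :: 'a poly"
  have q: "?q \<noteq> 0" "set (coeffs ?q) \<subseteq> \<rat>" "poly ?q x = 0" "degree ?q = degree f"
    using minimal_int_polyD[OF f]
    by (auto simp: set_coeffs_map_poly map_poly_eq_0_iff degree_map_poly)
  have alg: "(type_field.algebraic over \<rat>) x"
    using q(1,3)
    by (intro type_field.algebraicI[OF rev_coeffs_in_univ_poly[OF q(2)]])
      (simp_all add: eval_rev_coeffs)
  have dim: "type_field.dimension d \<rat> ?K"
    using type_field.dimension_simple_extension[OF subfield_Rats _ alg] by (simp add: d_def)
  note subring_K = type_field.simple_extension_is_subring[OF subfieldE(1)[OF subfield_Rats], of x]
  have "x ^ i \<in> ?K" for i
    using type_field.simple_extension_mem[OF subfieldE(1)[OF subfield_Rats], of x]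
      subringE(3,6)[OF subring_K] by (induction i) auto
  then obtain k :: "int poly" where k: "content k = 1" "degree k \<le> d"
      "(\<Sum>i\<le>d. of_int (coeff k i) * x ^ i) = 0"
    using dimension_Rats_primitive_relation[OF dim, of "\<lambda>i. x ^ i"] by blast
  have "ipoly k x = (\<Sum>i\<le>d. of_int (coeff k i) * x ^ i)"
    unfolding ipoly_altdef using k(2) by (intro sum.mono_neutral_left) (auto simp: coeff_eq_0)
  then have "f dvd k"
    using minimal_int_polyD(3)[OF f] k(3) by simp
  then have "degree f \<le> d"
    using k(1,2) dvd_imp_degree_le[of f k] by fastforce
  moreover have "d \<le> degree f"
    using degree_Irr_le[OF subfield_Rats alg q(1-3)] by (simp add: d_def q(4))
  ultimately show ?thesis using dim by simp
qed

lemma Rats_subset_number_field: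
  fixes F :: "'a::field_char_0 set"
  assumes "number_field_of_degree n F"
  shows "\<rat> \<subseteq> F"
proof
  fix q :: 'a assume "q \<in> \<rat>"
  moreover have F: "subfield F ring_of_type_algebra" "type_field.dimension n \<rat> F"
    using assms by (auto simp: number_field_of_degree_def)
  moreover have "1 \<in> F"
    using subringE(3)[OF subfieldE(1)[OF F(1)]] by simp
  ultimately show "q \<in> F"
    using type_field.space_subgroup_props(5)[OF subfield_Rats F(2), of q 1] by simp
qed

lemma number_field_degree_pos:
  fixes F :: "'a::field_char_0 set"
  assumes "number_field_of_degree n F"
  shows "n > 0"
proof (rule ccontr)
  assume "\<not> n > 0"
  then have "F = {0}"
    using assms type_field.dimension_zero[OF subfield_Rats, of F]
    by (auto simp: number_field_of_degree_def)
  then show False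
    using Rats_subset_number_field[OF assms] Rats_1 by auto
qed

lemma degree_minimal_int_poly_dvd:
  fixes F :: "'a::field_char_0 set"
  assumes F: "number_field_of_degree n F" and x: "x \<in> F" and f: "minimal_int_poly f x"
  shows "degree f dvd n"
proof -
  have subF: "subring F ring_of_type_algebra" and dimF: "type_field.dimension n \<rat> F"
    using F by (auto simp: number_field_of_degree_def dest: subfieldE(1))
  have "(type_field.algebraic over \<rat>) x"
    using type_field.finite_dimension_imp_algebraic[OF subfield_Rats subF _ x]
      type_field.finite_dimensionI[OF dimF] .
  then have "subfield (type_field.simple_extension \<rat> x) ring_of_type_algebra"
    using type_field.simple_extension_is_subfield[OF subfield_Rats, of x] by simp
  moreover have "\<rat> \<subseteq> type_field.simple_extension \<rat> x"
    by (rule type_field.simple_extension_incl) simp_all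
  moreover have "type_field.simple_extension \<rat> x \<subseteq> F"
    using Rats_subset_number_field[OF F] x
    by (rule type_field.simple_extension_subring_incl[OF subF])
  ultimately show ?thesis
    using type_field.dimension_intermediate_dvd[OF subfield_Rats _ subF]
      dimension_simple_extension_minimal_int_poly[OF f] dimF by blast
qed

section \<open>Totally ramified primes\<close>

lemma ring_of_integers_simps [simp]:
  "carrier (ring_of_integers F) = {x \<in> F. algebraic_int x}"
  "\<zero>\<^bsub>ring_of_integers F\<^esub> = 0"
  "\<one>\<^bsub>ring_of_integers F\<^esub> = 1"
  "x \<oplus>\<^bsub>ring_of_integers F\<^esub> y = x + y"
  "x \<otimes>\<^bsub>ring_of_integers F\<^esub> y = x * y"
  by (simp_all add: ring_of_integers_def)

lemma ring_of_integers_nat_pow [simp]: "x [^]\<^bsub>ring_of_integers F\<^esub> (k::nat) = x ^ k"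
  by (induction k) (simp_all add: mult.commute)

locale totally_ramified_prime = primeideal P "ring_of_integers F"
  for P and F :: "'a::field_char_0 set" +
  fixes n p :: nat
  assumes number_field: "number_field_of_degree n F"
    and prime_p: "prime p"
    and PIdl_p: "PIdl\<^bsub>ring_of_integers F\<^esub> (of_nat p) = P [^]\<^bsub>ideals_set (ring_of_integers F)\<^esub> n"

sublocale totally_ramified_prime \<subseteq> domain "ring_of_integers F"
  by unfold_locales auto

context totally_ramified_prime
begin

abbreviation integers :: "'a set" where
  "integers \<equiv> {x \<in> F. algebraic_int x}"

definition P_pow :: "nat \<Rightarrow> 'a set" where
  "P_pow i = P [^]\<^bsub>ideals_set (ring_of_integers F)\<^esub> i"

lemma n_pos: "n > 0"
  using number_field by (rule number_field_degree_pos)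

lemma of_int_mem_integers: "of_int c \<in> integers"
  using Rats_subset_number_field[OF number_field] Rats_of_int by auto

lemma ideal_add_mem:
  assumes "ideal I (ring_of_integers F)" "x \<in> I" "y \<in> I"
  shows "x + y \<in> I"
  using additive_subgroup.a_closed[OF ideal.axioms(1)[OF assms(1)] assms(2,3)] by simp

lemma ideal_int_mult_mem:
  assumes "ideal I (ring_of_integers F)" "x \<in> I"
  shows "of_int c * x \<in> I"
  using ideal.I_l_closed[OF assms, of "of_int c"] of_int_mem_integers[of c] by simp

lemma ideal_uminus_mem:
  assumes "ideal I (ring_of_integers F)" "x \<in> I"
  shows "- x \<in> I"
  using ideal_int_mult_mem[OF assms, of "- 1"] by simp

lemma ideal_sum_mem:
  assumes "ideal I (ring_of_integers F)" "\<And>j. j \<in> J \<Longrightarrow> f j \<in> I"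
  shows "sum f J \<in> I"
  using assms(2)
proof (induction J rule: infinite_finite_induct)
  case (insert j J)
  then show ?case using ideal_add_mem[OF assms(1)] by simp
qed (use additive_subgroup.zero_closed[OF ideal.axioms(1)[OF assms(1)]] in simp_all)

lemma P_pow_0: "P_pow 0 = integers"
  unfolding P_pow_def ideal_pow_0 by simp

lemma P_pow_Suc_0: "P_pow (Suc 0) = P"
  unfolding P_pow_def using ideal_pow_1[OF is_ideal] by simp

lemma P_pow_ideal: "ideal (P_pow i) (ring_of_integers F)"
  unfolding P_pow_def by (rule ideal_pow_is_ideal[OF is_ideal])

lemma P_pow_antimono: "i \<le> j \<Longrightarrow> P_pow j \<subseteq> P_pow i"
  unfolding P_pow_def by (rule ideal_pow_antimono[OF is_ideal])

lemma P_pow_subset: "P_pow i \<subseteq> integers"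
  using additive_subgroup.a_subset[OF ideal.axioms(1)[OF P_pow_ideal[of i]]] by simp

lemma P_pow_n: "P_pow n = (*) (of_nat p) ` integers"
  unfolding P_pow_def PIdl_p[symmetric] by (auto simp: cgenideal_def mult.commute)

lemma P_pow_Suc_psubset:
  assumes "i \<le> n"
  shows "P_pow (Suc i) \<subset> P_pow i"
proof -
  have "of_nat p \<in> integers" "(of_nat p :: 'a) \<noteq> 0"
    using of_int_mem_integers[of "int p"] prime_p by (auto simp: prime_gt_0_nat)
  then have "P_pow (Suc i) \<noteq> P_pow i"
    unfolding P_pow_def using assms I_notcarr
    by (intro cgenideal_ideal_pow_Suc_neq[OF is_ideal _ _ _ PIdl_p]) simp_all
  then show ?thesis
    using P_pow_antimono[of i "Suc i"] by auto
qed

lemma dvd_int_mult_mem_P_pow: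
  assumes "int p dvd c" "i \<le> n" "x \<in> integers"
  shows "of_int c * x \<in> P_pow i"
proof -
  obtain d where "c = d * int p"
    using assms(1) by (metis dvdE mult.commute)
  moreover have "of_nat p * x \<in> P_pow n"
    using assms(3) unfolding P_pow_n by blast
  then have "of_int d * (of_nat p * x) \<in> P_pow n"
    by (rule ideal_int_mult_mem[OF P_pow_ideal])
  ultimately show ?thesis
    using P_pow_antimono[OF assms(2)] by (auto simp: mult.assoc)
qed

lemma P_pow_int_mult_cancel:
  assumes "x \<in> integers" "i \<le> n" "\<not> int p dvd c" "of_int c * x \<in> P_pow i"
  shows "x \<in> P_pow i"
proof -
  have "coprime c (int p)"
    using prime_imp_coprime[of "int p" c] prime_p assms(3) by (simp add: coprime_commute)
  then obtain a b where "a * c + b * int p = 1"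
    using bezout_int[of c "int p"] by auto
  then have "of_int (a * c + b * int p) * x = x"
    by simp
  then have "of_int a * (of_int c * x) + of_int (b * int p) * x = x"
    by (simp add: distrib_right mult.assoc)
  moreover have "of_int a * (of_int c * x) \<in> P_pow i"
    using assms(4) by (rule ideal_int_mult_mem[OF P_pow_ideal])
  moreover have "of_int (b * int p) * x \<in> P_pow i"
    using assms(1,2) by (intro dvd_int_mult_mem_P_pow) simp_all
  ultimately show ?thesis
    using ideal_add_mem[OF P_pow_ideal] by metis
qed

lemma of_int_mem_P_iff: "of_int c \<in> P \<longleftrightarrow> int p dvd c"
proof
  assume "int p dvd c"
  then show "of_int c \<in> P"
    using dvd_int_mult_mem_P_pow[of c 1 1] n_pos of_int_mem_integers[of 1]
    by (simp add: P_pow_Suc_0)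
next
  assume "of_int c \<in> P"
  then have "1 \<in> P" if "\<not> int p dvd c"
    using P_pow_int_mult_cancel[of 1 1 c] that n_pos of_int_mem_integers[of 1]
    by (simp add: P_pow_Suc_0)
  then show "int p dvd c"
    using I_notcarr one_imp_carrier by auto
qed

definition graded_sequence :: "(nat \<Rightarrow> 'a) \<Rightarrow> bool" where
  "graded_sequence v \<longleftrightarrow> (\<forall>i<n. v i \<in> P_pow i - P_pow (Suc i))"

lemma graded_sequenceD:
  assumes "graded_sequence v" "i < n"
  shows "v i \<in> P_pow i" "v i \<notin> P_pow (Suc i)" "v i \<in> integers"
  using assms P_pow_subset[of i] by (auto simp: graded_sequence_def)

lemma dvd_coeffs_of_graded_sum:
  assumes v: "graded_sequence v"
    and sum: "(\<Sum>i<n. of_int (c i) * v i) \<in> P_pow n"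
    and i: "i < n"
  shows "int p dvd c i"
  using i
proof (induction i rule: less_induct)
  case (less i)
  have "of_int (c j) * v j \<in> P_pow (Suc i)" if "j \<in> {..<n} - {i}" for j
  proof (cases "j < i")
    case True
    then show ?thesis
      using less graded_sequenceD(3)[OF v, of j] by (intro dvd_int_mult_mem_P_pow) auto
  next
    case False
    then have "v j \<in> P_pow (Suc i)"
      using that graded_sequenceD(1)[OF v, of j] P_pow_antimono[of "Suc i" j] by auto
    then show ?thesis
      by (rule ideal_int_mult_mem[OF P_pow_ideal])
  qed
  then have "- (\<Sum>j\<in>{..<n} - {i}. of_int (c j) * v j) \<in> P_pow (Suc i)"
    by (intro ideal_uminus_mem[OF P_pow_ideal] ideal_sum_mem[OF P_pow_ideal])
  moreover have "(\<Sum>i<n. of_int (c i) * v i) \<in> P_pow (Suc i)"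
    using sum P_pow_antimono[of "Suc i" n] less.prems by auto
  ultimately have "(\<Sum>j<n. of_int (c j) * v j)
      + - (\<Sum>j\<in>{..<n} - {i}. of_int (c j) * v j) \<in> P_pow (Suc i)"
    using ideal_add_mem[OF P_pow_ideal] by blast
  then have "of_int (c i) * v i \<in> P_pow (Suc i)"
    using less.prems by (simp add: sum.remove[of "{..<n}" i])
  then show ?case
    using P_pow_int_mult_cancel[of "v i" "Suc i" "c i"] graded_sequenceD[OF v less.prems] less.prems
    by auto
qed

lemma graded_sequence_exists:
  obtains v where "graded_sequence v" "v 0 = 1"
proof -
  have "\<exists>y. y \<in> P_pow i - P_pow (Suc i)" if "i < n" for i
    using P_pow_Suc_psubset[of i] that by auto
  then obtain v where "\<And>i. i < n \<Longrightarrow> v i \<in> P_pow i - P_pow (Suc i)"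
    by metis
  then have "graded_sequence (v(0 := 1))"
    using of_int_mem_integers[of 1] of_int_mem_P_iff[of 1] prime_p
    by (auto simp: graded_sequence_def P_pow_0 P_pow_Suc_0)
  then show thesis
    by (rule that) simp
qed

lemma graded_relation:
  assumes x: "x \<in> integers" and v: "graded_sequence v"
  obtains c :: "nat \<Rightarrow> int"
  where "\<not> int p dvd c n" "of_int (c n) * x = - (\<Sum>i<n. of_int (c i) * v i)"
proof -
  have F: "type_field.dimension n \<rat> F"
    using number_field by (simp add: number_field_of_degree_def)
  have "(v(n := x)) i \<in> F" if "i \<le> n" for i
    using that x graded_sequenceD(3)[OF v, of i] by auto
  then obtain k :: "int poly" where k: "content k = 1" "degree k \<le> n"
      and relation: "(\<Sum>i\<le>n. of_int (poly.coeff k i) * (v(n := x)) i) = 0"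
    using dimension_Rats_primitive_relation[OF F] by blast
  define c where "c = poly.coeff k"
  have x_eq: "of_int (c n) * x = - (\<Sum>i<n. of_int (c i) * v i)"
    using relation by (simp add: c_def eq_neg_iff_add_eq_0 add.commute flip: lessThan_Suc_atMost)
  moreover have "\<not> int p dvd c n"
  proof
    assume dvd: "int p dvd c n"
    then have "- (of_int (c n) * x) \<in> P_pow n"
      using x by (intro ideal_uminus_mem[OF P_pow_ideal] dvd_int_mult_mem_P_pow) auto
    then have "int p dvd c i" if "i < n" for i
      using dvd_coeffs_of_graded_sum[OF v _ that, of c] x_eq by simp
    then have "int p dvd c i" for i
      using dvd k(2) by (cases i n rule: linorder_cases) (auto simp: c_def coeff_eq_0)
    then have "int p dvd content k"
      by (simp add: c_def const_poly_dvd_iff flip: const_poly_dvd_iff_dvd_content)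
    then show False
      using k(1) prime_p by auto
  qed
  ultimately show thesis by (rule that[rotated])
qed

lemma integer_residue:
  assumes x: "x \<in> integers"
  obtains a :: int where "x - of_int a \<in> P"
proof -
  obtain v where v: "graded_sequence v" "v 0 = 1"
    by (rule graded_sequence_exists)
  obtain c where c: "\<not> int p dvd c n" and x_eq: "of_int (c n) * x = - (\<Sum>i<n. of_int (c i) * v i)"
    using graded_relation[OF x v(1)] .
  obtain b where b: "[c n * b = 1] (mod int p)"
    using cong_solve_coprime_int[of "c n" "int p"] prime_imp_coprime[of "int p" "c n"] prime_p c
    by (auto simp: coprime_commute)
  have "of_int (c n) * x + of_int (c 0) = - (\<Sum>i\<in>{..<n} - {0}. of_int (c i) * v i)"
    using n_pos by (simp add: x_eq sum.remove[of "{..<n}" 0] v(2))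
  also have "\<dots> \<in> P"
  proof (intro ideal_uminus_mem ideal_sum_mem ideal_int_mult_mem is_ideal)
    show "v i \<in> P" if "i \<in> {..<n} - {0}" for i
      using that graded_sequenceD(1)[OF v(1), of i] P_pow_antimono[of "Suc 0" i]
      by (auto simp: P_pow_Suc_0)
  qed
  finally have "of_int b * (of_int (c n) * x + of_int (c 0)) \<in> P"
    by (rule ideal_int_mult_mem[OF is_ideal])
  moreover have "of_int (1 - c n * b) * x \<in> P"
    using dvd_int_mult_mem_P_pow[of "1 - c n * b" "Suc 0" x] b x n_pos
    by (simp add: P_pow_Suc_0 cong_iff_dvd_diff dvd_diff_commute)
  ultimately have "of_int b * (of_int (c n) * x + of_int (c 0)) + of_int (1 - c n * b) * x \<in> P"
    by (rule ideal_add_mem[OF is_ideal])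
  then show thesis
    by (intro that[of "- b * c 0"]) (simp add: algebra_simps)
qed

lemma unit_residue_cong:
  assumes x: "x \<in> Units (ring_of_integers F)" and a: "x - of_int a \<in> P"
  shows "[a ^ (2 * n) = 1] (mod int p)"
proof -
  define w where "w = x - of_int a"
  have w: "w \<in> P" "w \<in> F" "algebraic_int w"
    using a Icarr[OF a] by (simp_all add: w_def)
  obtain f where f: "minimal_int_poly f w"
    using minimal_int_poly_exists[OF w(3)] .
  have "w ^ n \<in> P_pow n"
    using nat_pow_mem_ideal_pow[OF is_ideal w(1)] by (simp add: P_pow_def)
  then obtain y where "algebraic_int y" "w ^ n = of_int (int p) * y"
    unfolding P_pow_n by auto
  then have "weakly_eisenstein (int p) f"
    using minimal_int_poly_weakly_eisenstein[OF f] prime_p n_pos by simp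
  moreover obtain z where "algebraic_int z" "z * x = 1"
    using x by (auto simp: Units_def)
  then have "x \<noteq> 0" "algebraic_int (inverse x)"
    by (auto simp: inverse_unique mult.commute)
  ultimately have "[(- a) ^ (2 * degree f) = 1] (mod int p)"
    by (intro minimal_int_poly_residue_cong[OF f]) (auto simp: w_def)
  moreover obtain m where m: "n = degree f * m"
    using degree_minimal_int_poly_dvd[OF number_field w(2) f] by (elim dvdE)
  ultimately have "[((- a) ^ (2 * degree f)) ^ m = 1] (mod int p)"
    using cong_pow by fastforce
  then show ?thesis
    by (simp add: m mult.assoc flip: power_mult)
qed

lemma unit_residue_pm_one:
  assumes x: "x \<in> Units (ring_of_integers F)"
    and p: "p > 2" and coprime: "gcd n ((p - 1) div 2) = 1"
  obtains s :: int where "s \<in> {1, - 1}" "x - of_int s \<in> P"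
proof -
  obtain a where a: "x - of_int a \<in> P"
    using integer_residue x by (auto simp: Units_def)
  obtain s where s: "s \<in> {1, - 1}" "[a = s] (mod int p)"
    using cong_pow_double_one_imp_cong_pm_one[OF prime_p p coprime n_pos] unit_residue_cong[OF x a]
    by blast
  then have "of_int (a - s) \<in> P"
    by (simp only: of_int_mem_P_iff cong_iff_dvd_diff)
  then have "x - of_int s \<in> P"
    using ideal_add_mem[OF is_ideal a] by fastforce
  then show thesis using s(1) that by blast
qed

end

lemma totally_ramified_primeE:
  assumes F: "number_field_of_degree n F" and p: "prime p" and ram: "totally_ramified p F"
  obtains P where "totally_ramified_prime P F n p"
proof -
  obtain m P where m: "number_field_of_degree m F" and P: "primeideal P (ring_of_integers F)"
    and eq: "PIdl\<^bsub>ring_of_integers F\<^esub> (of_nat p) = P [^]\<^bsub>ideals_set (ring_of_integers F)\<^esub> m"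
    using ram by (auto simp: totally_ramified_def)
  have "m = n"
    using m F type_field.dimension_is_inj[OF subfield_Rats]
    by (auto simp: number_field_of_degree_def)
  then show thesis
    using F p P eq
    by (intro that[of P] totally_ramified_prime.intro totally_ramified_prime_axioms.intro) auto
qed

theorem theorem4:
  fixes F :: "'a::field_char_0 set" and n p :: nat
  assumes "number_field_of_degree n F"
    and "Factorial_Ring.prime p" and "p \<ge> 5"
    and "gcd n ((p - 1) div 2) = 1"
    and "totally_ramified p F"
  shows "\<not> (\<exists>l\<in>Units (ring_of_integers F). \<exists>m\<in>Units (ring_of_integers F). l + m = 1)"
proof
  assume "\<exists>l\<in>Units (ring_of_integers F). \<exists>m\<in>Units (ring_of_integers F). l + m = 1"
  then obtain l m where l: "l \<in> Units (ring_of_integers F)" and m: "m \<in> Units (ring_of_integers F)"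
    and sum: "l + m = 1" by blast
  obtain P where "totally_ramified_prime P F n p"
    using totally_ramified_primeE[OF assms(1,2,5)] .
  then interpret totally_ramified_prime P F n p .
  have "p > 2" using assms(3) by simp
  obtain s t :: int where s: "s \<in> {1, - 1}" "l - of_int s \<in> P"
    and t: "t \<in> {1, - 1}" "m - of_int t \<in> P"
    using unit_residue_pm_one[OF _ \<open>p > 2\<close> assms(4)] l m by metis
  have "of_int (1 - s - t) = (l - of_int s) + (m - of_int t)"
    using sum by (simp add: algebra_simps)
  then have "int p dvd 1 - s - t"
    using ideal_add_mem[OF is_ideal s(2) t(2)] by (simp only: of_int_mem_P_iff[symmetric])
  moreover have "1 - s - t \<noteq> 0" "\<bar>1 - s - t\<bar> \<le> 3"
    using s(1) t(1) by auto
  ultimately show False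
    using assms(3) dvd_imp_le_int[of "1 - s - t" "int p"] by linarith
qed

end
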